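(* Let $n\ge2$ be an integer, $\lambda=\frac{n-1}{2}$, $m\in\mathbb N=\{1,2,\dots\}$, $a>0$. The Poisson wavelet $g_a^m$ on $\mathcal S^n$ has the Gegenbauer expansion $$g_a^{m}(y)=\frac{1}{\Sigma_n}\,\sum_{l=0}^\infty\frac{\lambda+l}{\lambda}\,(al)^m e^{-al}\,C_l^\lambda(\cos\theta),\qquad y\in\mathcal S^n,\ \cos\theta=\hat e\cdot y.$$
   Context: $\mathcal S^n$ is the unit sphere in $\mathbb R^{n+1}$, $\hat e=(1,0,\dots,0)$ its north pole, and $\Sigma_n=\frac{2\pi^{\lambda+1}}{\Gamma(\lambda+1)}$ its surface measure. The Gegenbauer polynomials $C_l^\lambda$ are defined by $\sum_{l=0}^\infty C_l^\lambda(t)\,r^l=(1-2tr+r^2)^{-\lambda}$ for $t\in[-1,1]$, $|r|<1$. Poisson kernel: for $0\le r<1$ and $y\in\mathcal S^n$ with $\cos\theta=\hat e\cdot y$, $$p_{r\hat e}(y)=\frac{1}{\Sigma_n}\frac{1-r^2}{(1-2r\cos\theta+r^2)^{(n+1)/2}}.$$ The Poisson wavelet of order $m\in\mathbb N$ at scale $a>0$ is the function on $\mathcal S^n$ $$g_a^m(y)=a^m\left[(r\partial_r)^m p_{r\hat e}(y)\right]_{r=e^{-a}}.$$ *)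

theory Defs
  imports "HOL-Analysis.Analysis"
begin

text \<open>
  The ambient space \<open>\<real>\<^sup>n\<^sup>+\<^sup>1\<close> is \<open>\<real> \<times> \<real>\<^sup>n\<close>, rendered as the type \<open>real \<times> (real ^ 'n)\<close> with
  \<open>n = CARD('n)\<close>; the library's norm and inner product on it are the Euclidean ones.
\<close>

definition north_pole :: "real \<times> (real ^ 'n)" where
  "north_pole = (1, 0)"

definition sphere_area :: "nat \<Rightarrow> real" where
  "sphere_area n =
     (let lam = (real n - 1) / 2 in 2 * pi powr (lam + 1) / Gamma (lam + 1))"

text \<open>
  The coefficient sequence is determined by the generating function for \<open>t \<in> {-1..1}\<close>, the only
  range in which the value is meaningful: for \<open>\<bar>t\<bar> > 1\<close> the expansion need not be valid on the
  whole interval \<open>\<bar>r\<bar> < 1\<close>.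
\<close>

definition gegenbauer :: "nat \<Rightarrow> real \<Rightarrow> real \<Rightarrow> real" where
  "gegenbauer l lam t =
     (THE c :: nat \<Rightarrow> real.
        \<forall>r::real. \<bar>r\<bar> < 1 \<longrightarrow> (\<lambda>k. c k * r ^ k) sums (1 - 2 * t * r + r\<^sup>2) powr (- lam)) l"

text \<open>\<open>poisson_kernel r y\<close> is \<open>p\<close> with pole \<open>r\<close> times the north pole; it is used for \<open>0 \<le> r < 1\<close>.\<close>

definition poisson_kernel :: "real \<Rightarrow> real \<times> (real ^ 'n) \<Rightarrow> real" where
  "poisson_kernel r y =
     1 / sphere_area CARD('n) *
     ((1 - r\<^sup>2) / (1 - 2 * r * (north_pole \<bullet> y) + r\<^sup>2) powr ((real CARD('n) + 1) / 2))"

definition euler_op :: "(real \<Rightarrow> real) \<Rightarrow> real \<Rightarrow> real" where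
  "euler_op f = (\<lambda>r. r * deriv f r)"

definition poisson_wavelet :: "nat \<Rightarrow> real \<Rightarrow> real \<times> (real ^ 'n) \<Rightarrow> real" where
  "poisson_wavelet m a y = a ^ m * (euler_op ^^ m) (\<lambda>r. poisson_kernel r y) (exp (- a))"

end

theory Submission
  imports Defs
begin

text \<open>
  On \<open>\<bar>r\<bar> < 1\<close> the Euler operator \<open>r \<partial>\<^sub>r\<close> acts on power series by multiplying the \<open>l\<close>-th
  coefficient by \<open>l\<close> (\<open>euler_op_sums\<close>), and this explains both the weight \<open>(\<lambda> + l) / \<lambda>\<close> and the
  factor \<open>l\<^sup>m\<close> in the expansion. Let \<open>G(r) = (1 - 2tr + r\<^sup>2)\<^sup>-\<^sup>\<lambda>\<close> be the generating function of the
  Gegenbauer polynomials. The function \<open>G + (r \<partial>\<^sub>r G) / \<lambda>\<close> has the coefficients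
  \<open>(\<lambda> + l) / \<lambda> * C\<^sub>l\<close>, and differentiating \<open>G\<close> shows that it is \<open>\<Sigma>\<^sub>n\<close> times the Poisson kernel
  (\<open>poisson_gegenbauer_sums\<close>). A further \<open>m\<close> applications of \<open>r \<partial>\<^sub>r\<close>, followed by \<open>r = e\<^sup>-\<^sup>a\<close> and
  multiplication by \<open>a\<^sup>m\<close>, give the wavelet.

  The Gegenbauer coefficients are described as the unique sequence whose power series is \<open>G\<close> on the
  whole of \<open>\<bar>r\<bar> < 1\<close>, so the argument also needs that such a sequence exists for \<open>\<bar>t\<bar> \<le> 1\<close>. With
  \<open>t = cos \<theta>\<close> one has \<open>1 - 2tr + r\<^sup>2 = \<bar>1 - r e\<^sup>i\<^sup>\<theta>\<bar>\<^sup>2\<close>; hence \<open>G\<close> is the product of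
  \<open>(1 - r e\<^sup>i\<^sup>\<theta>)\<^sup>-\<^sup>\<lambda>\<close> and its conjugate, and the Cauchy product of their binomial series provides
  the expansion (\<open>gegenbauer_generating_expansion\<close>).
\<close>

section \<open>Existence and uniqueness of the generating expansion\<close>

text \<open>
  The constant term is the limit at \<open>0\<close>; subtracting it and dividing by \<open>x\<close> shifts the sequence,
  so induction reaches every coefficient. Leaving out \<open>x = 0\<close> in the hypotheses is what allows
  this division.
\<close>

lemma powser_coeffs_unique:
  fixes a b :: "nat \<Rightarrow> 'a::{real_normed_field,banach}"
  assumes "s > 0"
    and "\<And>x. x \<noteq> 0 \<Longrightarrow> norm x < s \<Longrightarrow> (\<lambda>k. a k * x ^ k) sums f x"
    and "\<And>x. x \<noteq> 0 \<Longrightarrow> norm x < s \<Longrightarrow> (\<lambda>k. b k * x ^ k) sums f x"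
  shows "a n = b n"
  using assms(2,3)
proof (induction n arbitrary: a b f)
  case 0
  from powser_limit_0_strong[OF \<open>s > 0\<close> "0.prems"(1)] powser_limit_0_strong[OF \<open>s > 0\<close> "0.prems"(2)]
  show ?case by (rule LIM_unique)
next
  case (Suc n)
  have "a 0 = b 0"
    using powser_limit_0_strong[OF \<open>s > 0\<close> Suc.prems(1)] powser_limit_0_strong[OF \<open>s > 0\<close> Suc.prems(2)]
    by (rule LIM_unique)
  have shift: "(\<lambda>k. c (Suc k) * x ^ k) sums ((f x - c 0) / x)"
    if "(\<lambda>k. c k * x ^ k) sums f x" "x \<noteq> 0" for c x
  proof -
    have "(\<lambda>k. c (Suc k) * x ^ Suc k) sums (f x - c 0)"
      using that(1) by (subst sums_Suc_iff) simp
    from sums_divide[OF this, of x] show ?thesis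
      using that(2) by (simp add: field_simps)
  qed
  show ?case
  proof (rule Suc.IH[of "\<lambda>k. a (Suc k)" "\<lambda>x. (f x - a 0) / x" "\<lambda>k. b (Suc k)"])
    show "(\<lambda>k. a (Suc k) * x ^ k) sums ((f x - a 0) / x)" if "x \<noteq> 0" "norm x < s" for x
      using shift Suc.prems(1) that by blast
    show "(\<lambda>k. b (Suc k) * x ^ k) sums ((f x - a 0) / x)" if "x \<noteq> 0" "norm x < s" for x
      unfolding \<open>a 0 = b 0\<close> using shift Suc.prems(2) that by blast
  qed
qed

text \<open>
  A factorisation over the unit circle, \<open>1 - 2tr + r\<^sup>2 = (1 - ru) (1 - r cnj u)\<close> with
  \<open>u = e\<^sup>i\<^sup>\<theta>\<close> and \<open>t = cos \<theta>\<close>, makes both binomial series converge on all of \<open>\<bar>r\<bar> < 1\<close>; this is where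
  \<open>\<bar>t\<bar> \<le> 1\<close> enters.
\<close>

lemma gegenbauer_generating_expansion:
  fixes lam t :: real
  assumes "\<bar>t\<bar> \<le> 1"
  obtains c :: "nat \<Rightarrow> real"
  where "\<And>r. \<bar>r\<bar> < 1 \<Longrightarrow> (\<lambda>k. c k * r ^ k) sums (1 - 2 * t * r + r\<^sup>2) powr (- lam)"
proof -
  define u where "u = cis (arccos t)"
  have u: "norm u = 1" "Re u = t" using assms by (auto simp: u_def)
  define b where "b = (\<lambda>k. (complex_of_real (- lam) gchoose k) * (- u) ^ k)"
  \<comment> \<open>For real \<open>r\<close> the Cauchy product has a real sum, so the real parts of its coefficients suffice.\<close>
  define c where "c = (\<lambda>k. Re (\<Sum>i\<le>k. b i * cnj (b (k - i))))"
  have "(\<lambda>k. c k * r ^ k) sums (1 - 2 * t * r + r\<^sup>2) powr (- lam)" if r: "\<bar>r\<bar> < 1" for r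
  proof -
    define h where "h = (\<lambda>r. (1 - of_real r * u) powr complex_of_real (- lam))"
    have binom: "(\<lambda>k. b k * of_real s ^ k) sums h s" if "\<bar>s\<bar> < 1" for s
    proof -
      have "norm (of_real s * - u) < 1"
        using that u by (simp add: norm_mult)
      from gen_binomial_complex[OF this, of "of_real (- lam)"]
      have "(\<lambda>k. (of_real (- lam) gchoose k) * (of_real s ^ k * (- u) ^ k)) sums h s"
        unfolding power_mult_distrib by (simp add: h_def)
      then show ?thesis
        unfolding b_def by (simp only: mult_ac)
    qed
    \<comment> \<open>Comparison with a point closer to the unit circle gives absolute convergence.\<close>
    have "\<bar>(\<bar>r\<bar> + 1) / 2\<bar> < 1" using r by simp
    from sums_summable[OF binom[OF this]]
    have abs_conv: "summable (\<lambda>k. norm (b k * of_real r ^ k))"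
      by (rule powser_insidea) (use r in simp)
    have abs_conv': "summable (\<lambda>k. norm (cnj (b k * of_real r ^ k)))"
      using abs_conv by (simp add: norm_mult norm_power)
    have "(\<lambda>k. cnj (b k * of_real r ^ k)) sums cnj (h r)"
      using binom[OF r] by (simp only: sums_cnj)
    with Cauchy_product_sums[OF abs_conv abs_conv'] binom[OF r]
    have "(\<lambda>k. \<Sum>i\<le>k. (b i * of_real r ^ i) * cnj (b (k - i) * of_real r ^ (k - i)))
            sums (h r * cnj (h r))"
      by (simp add: sums_iff)
    also have "(\<lambda>k. \<Sum>i\<le>k. (b i * of_real r ^ i) * cnj (b (k - i) * of_real r ^ (k - i))) =
               (\<lambda>k. of_real (r ^ k) * (\<Sum>i\<le>k. b i * cnj (b (k - i))))"
    proof
      fix k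
      have "(b i * of_real r ^ i) * cnj (b (k - i) * of_real r ^ (k - i)) =
            of_real (r ^ k) * (b i * cnj (b (k - i)))" if "i \<le> k" for i
      proof -
        have "complex_of_real r ^ k = of_real r ^ i * of_real r ^ (k - i)"
          using that by (simp flip: power_add)
        then show ?thesis by simp
      qed
      then show "(\<Sum>i\<le>k. (b i * of_real r ^ i) * cnj (b (k - i) * of_real r ^ (k - i))) =
                 of_real (r ^ k) * (\<Sum>i\<le>k. b i * cnj (b (k - i)))"
        unfolding sum_distrib_left by (intro sum.cong) auto
    qed
    finally have "(\<lambda>k. Re (of_real (r ^ k) * (\<Sum>i\<le>k. b i * cnj (b (k - i))))) sums
                    Re (h r * cnj (h r))"
      by (rule sums_Re)
    then have "(\<lambda>k. c k * r ^ k) sums Re (h r * cnj (h r))"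
      by (simp add: c_def mult.commute del: of_real_power)
    also have "Re (h r * cnj (h r)) = (norm (h r))\<^sup>2"
      by (simp add: complex_mult_cnj cmod_power2)
    also have "norm (h r) = norm (1 - of_real r * u) powr (- lam)"
      unfolding h_def by (subst norm_powr_real_powr') auto
    also have "(norm (1 - of_real r * u) powr (- lam))\<^sup>2 = ((norm (1 - of_real r * u))\<^sup>2) powr (- lam)"
      by (simp add: power2_eq_square powr_mult)
    also have "(norm (1 - of_real r * u))\<^sup>2 = 1 - 2 * t * r + r\<^sup>2"
    proof -
      have "(Re u)\<^sup>2 + (Im u)\<^sup>2 = 1"
        using cmod_power2[of u] u(1) by simp
      then have "r\<^sup>2 * (Re u)\<^sup>2 + r\<^sup>2 * (Im u)\<^sup>2 = r\<^sup>2"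
        by (metis distrib_left mult.right_neutral)
      then show ?thesis
        by (simp add: cmod_power2 u(2) power2_diff power_mult_distrib)
    qed
    finally show ?thesis .
  qed
  then show thesis by (rule that)
qed

lemma gegenbauer_sums:
  assumes "\<bar>t\<bar> \<le> 1" and "\<bar>r\<bar> < 1"
  shows "(\<lambda>l. gegenbauer l lam t * r ^ l) sums (1 - 2 * t * r + r\<^sup>2) powr (- lam)"
proof -
  let ?P = "\<lambda>c. \<forall>r::real. \<bar>r\<bar> < 1 \<longrightarrow>
              (\<lambda>k. c k * r ^ k) sums (1 - 2 * t * r + r\<^sup>2) powr (- lam)"
  obtain c where c: "?P c"
    using gegenbauer_generating_expansion[OF assms(1), of lam] by metis
  have "c' = c" if "?P c'" for c'
  proof
    show "c' n = c n" for n
      by (rule powser_coeffs_unique[where s = 1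
            and f = "\<lambda>r. (1 - 2 * t * r + r\<^sup>2) powr (- lam)"]) (use that c in auto)
  qed
  with c have "(THE c. ?P c) = c" by (rule the_equality)
  then have "gegenbauer l lam t = c l" for l
    by (simp add: gegenbauer_def)
  with c assms(2) show ?thesis by simp
qed

section \<open>The Euler operator on power series\<close>

lemma euler_op_sums:
  fixes c :: "nat \<Rightarrow> real"
  assumes sums: "\<And>r. \<bar>r\<bar> < 1 \<Longrightarrow> (\<lambda>k. c k * r ^ k) sums f r" and r: "\<bar>r\<bar> < 1"
  shows "(\<lambda>k. real k * c k * r ^ k) sums euler_op f r"
proof -
  have summable: "summable (\<lambda>k. c k * x ^ k)" if "norm x < 1" for x
    using sums that by (auto intro: sums_summable)
  have "((\<lambda>x. \<Sum>k. c k * x ^ k) has_field_derivative (\<Sum>k. diffs c k * r ^ k)) (at r)"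
    by (rule termdiffs_strong'[OF summable]) (use r in auto)
  then have "(f has_field_derivative (\<Sum>k. diffs c k * r ^ k)) (at r)"
    by (rule has_field_derivative_transform_within_open[where S = "ball 0 1"])
       (use sums r in \<open>auto simp: sums_iff\<close>)
  then have deriv: "deriv f r = (\<Sum>k. diffs c k * r ^ k)"
    by (rule DERIV_imp_deriv)
  have "summable (\<lambda>k. diffs c k * r ^ k)"
    by (rule termdiff_converges[of r 1]) (use summable r in auto)
  then have "(\<lambda>k. real k * c k * r ^ (k - Suc 0)) sums deriv f r"
    unfolding deriv by (rule diffs_equiv)
  then have "(\<lambda>k. r * (real k * c k * r ^ (k - Suc 0))) sums (r * deriv f r)"
    by (rule sums_mult)
  moreover have "r * (real k * c k * r ^ (k - Suc 0)) = real k * c k * r ^ k" for k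
    by (cases k) auto
  ultimately show ?thesis
    by (simp add: euler_op_def)
qed

lemma euler_op_iterate_sums:
  fixes c :: "nat \<Rightarrow> real"
  assumes "\<And>r. \<bar>r\<bar> < 1 \<Longrightarrow> (\<lambda>k. c k * r ^ k) sums f r" and "\<bar>r\<bar> < 1"
  shows "(\<lambda>k. real k ^ m * c k * r ^ k) sums (euler_op ^^ m) f r"
  using assms(2)
proof (induction m arbitrary: r)
  case 0
  then show ?case using assms(1) by simp
next
  case (Suc m)
  from euler_op_sums[OF Suc.IH Suc.prems] show ?case
    by (simp add: mult.assoc)
qed

section \<open>The Poisson kernel and the Poisson wavelet\<close>

lemma gegenbauer_base_pos:
  fixes t r :: real
  assumes "\<bar>t\<bar> \<le> 1" and "\<bar>r\<bar> < 1"
  shows "1 - 2 * t * r + r\<^sup>2 > 0"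
proof -
  have "\<bar>t * r\<bar> \<le> \<bar>r\<bar>"
    using assms(1) by (simp add: abs_mult mult_left_le_one_le)
  moreover have "(1 - \<bar>r\<bar>)\<^sup>2 > 0" using assms(2) by simp
  then have "1 - 2 * \<bar>r\<bar> + r\<^sup>2 > 0" by (simp add: power2_diff)
  ultimately show ?thesis by (simp add: mult.assoc)
qed

text \<open>
  With \<open>B = 1 - 2tr + r\<^sup>2\<close> and \<open>G = B\<^sup>-\<^sup>\<lambda>\<close>, one has
  \<open>G + (r \<partial>\<^sub>r G) / \<lambda> = B\<^sup>-\<^sup>\<lambda>\<^sup>-\<^sup>1 (B - r (2r - 2t))\<close>, and the last factor is \<open>1 - r\<^sup>2\<close>.
\<close>

lemma poisson_gegenbauer_sums:
  assumes "lam \<noteq> 0" and t: "\<bar>t\<bar> \<le> 1" and r: "\<bar>r\<bar> < 1"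
  shows "(\<lambda>l. (lam + real l) / lam * gegenbauer l lam t * r ^ l) sums
           ((1 - r\<^sup>2) / (1 - 2 * t * r + r\<^sup>2) powr (lam + 1))"
proof -
  define G where "G = (\<lambda>r. (1 - 2 * t * r + r\<^sup>2) powr (- lam))"
  define B where "B = 1 - 2 * t * r + r\<^sup>2"
  have "B > 0" using gegenbauer_base_pos[OF t r] by (simp add: B_def)
  have G_sums: "(\<lambda>l. gegenbauer l lam t * x ^ l) sums G x" if "\<bar>x\<bar> < 1" for x
    using gegenbauer_sums[OF t that] by (simp add: G_def)
  have "(G has_field_derivative - lam * B powr (- lam - 1) * (2 * r - 2 * t)) (at r)"
    unfolding G_def B_def using gegenbauer_base_pos[OF t r]
    by (auto intro!: derivative_eq_intros simp: powr_diff field_simps)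
  then have euler: "euler_op G r = r * (- lam * B powr (- lam - 1) * (2 * r - 2 * t))"
    by (simp add: euler_op_def DERIV_imp_deriv)
  have powr: "B powr (- lam) = B * B powr (- lam - 1)"
    using \<open>B > 0\<close> by (simp add: powr_diff)
  have "G r + euler_op G r / lam = B powr (- lam - 1) * (B - r * (2 * r - 2 * t))"
    unfolding euler using \<open>lam \<noteq> 0\<close> powr by (simp add: G_def flip: B_def) (simp add: algebra_simps)
  also have "B - r * (2 * r - 2 * t) = 1 - r\<^sup>2"
    by (simp add: B_def power2_eq_square algebra_simps)
  also have "B powr (- lam - 1) = 1 / B powr (lam + 1)"
    by (simp add: powr_minus_divide[symmetric])
  finally have kernel: "G r + euler_op G r / lam = (1 - r\<^sup>2) / B powr (lam + 1)"
    by simp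
  have "(\<lambda>l. gegenbauer l lam t * r ^ l + real l * gegenbauer l lam t * r ^ l / lam) sums
          (G r + euler_op G r / lam)"
    by (intro sums_add sums_divide G_sums euler_op_sums r)
  moreover have "gegenbauer l lam t * r ^ l + real l * gegenbauer l lam t * r ^ l / lam =
                 (lam + real l) / lam * gegenbauer l lam t * r ^ l" for l
    using \<open>lam \<noteq> 0\<close> by (simp add: field_simps)
  ultimately show ?thesis
    unfolding kernel by (simp add: B_def)
qed

theorem lemma3p2:
  fixes n m :: nat and lam a \<theta> :: real and y :: "real \<times> (real ^ 'n)"
  assumes "n = CARD('n)" and "n \<ge> 2"
    and "lam = (real n - 1) / 2"
    and "m \<ge> 1" and "a > 0"
    and "y \<in> sphere 0 1" and "cos \<theta> = north_pole \<bullet> y"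
  shows "summable (\<lambda>l. (lam + real l) / lam * (a * real l) ^ m * exp (- (a * real l)) *
                        gegenbauer l lam (cos \<theta>)) \<and>
         poisson_wavelet m a y =
           1 / sphere_area n *
           (\<Sum>l. (lam + real l) / lam * (a * real l) ^ m * exp (- (a * real l)) *
                 gegenbauer l lam (cos \<theta>))"
proof -
  define C where "C = (\<lambda>l. (lam + real l) / lam * gegenbauer l lam (cos \<theta>))"
  define A where "A = 1 / sphere_area n"
  have "lam \<noteq> 0" using assms(2,3) by simp
  have exponent: "(real n + 1) / 2 = lam + 1"
    using assms(3) by (simp add: field_simps)
  have "A \<noteq> 0"
  proof -
    have "Gamma (lam + 1) > 0"
      using assms(2,3) by (intro Gamma_real_pos) (simp add: field_simps)
    then show ?thesis
      by (simp add: A_def sphere_area_def Let_def flip: assms(3))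
  qed
  have "(\<lambda>l. A * (C l * r ^ l)) sums poisson_kernel r y" if "\<bar>r\<bar> < 1" for r
  proof -
    have "(\<lambda>l. A * (C l * r ^ l)) sums
            (A * ((1 - r\<^sup>2) / (1 - 2 * cos \<theta> * r + r\<^sup>2) powr (lam + 1)))"
      unfolding C_def using \<open>lam \<noteq> 0\<close> that by (intro sums_mult poisson_gegenbauer_sums) auto
    then show ?thesis
      unfolding poisson_kernel_def exponent A_def assms(7)[symmetric] assms(1)[symmetric]
      by (simp only: mult_ac)
  qed
  then have "(\<lambda>l. A * C l * r ^ l) sums poisson_kernel r y" if "\<bar>r\<bar> < 1" for r
    using that by (simp add: mult.assoc)
  then have "(\<lambda>l. real l ^ m * (A * C l) * exp (- a) ^ l) sums
               (euler_op ^^ m) (\<lambda>r. poisson_kernel r y) (exp (- a))"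
    by (rule euler_op_iterate_sums) (use \<open>a > 0\<close> in simp_all)
  from sums_mult[OF this, of "a ^ m"]
  have "(\<lambda>l. a ^ m * (real l ^ m * (A * C l) * exp (- a) ^ l)) sums poisson_wavelet m a y"
    by (simp only: poisson_wavelet_def)
  moreover have "a ^ m * (real l ^ m * (A * C l) * exp (- a) ^ l) =
      A * ((lam + real l) / lam * (a * real l) ^ m * exp (- (a * real l)) *
           gegenbauer l lam (cos \<theta>))" for l
  proof -
    have "exp (- a) ^ l = exp (- (a * real l))"
      by (simp add: exp_of_nat_mult[symmetric] mult.commute)
    then show ?thesis
      by (simp add: C_def power_mult_distrib)
  qed
  ultimately have expansion:
    "(\<lambda>l. A * ((lam + real l) / lam * (a * real l) ^ m * exp (- (a * real l)) *
               gegenbauer l lam (cos \<theta>))) sums poisson_wavelet m a y"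
    by simp
  \<comment> \<open>Summability without the factor \<open>A\<close> follows because the area of the sphere is not zero.\<close>
  have summable: "summable (\<lambda>l. (lam + real l) / lam * (a * real l) ^ m * exp (- (a * real l)) *
                                gegenbauer l lam (cos \<theta>))"
    using sums_summable[OF expansion] \<open>A \<noteq> 0\<close> by (simp only: summable_cmult_iff) simp
  from sums_unique2[OF expansion sums_mult[OF summable_sums[OF summable]]] summable
  show ?thesis unfolding A_def by blast
qed

end
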